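(* Let $g(t)$, $t\in\mathbb{R}$, be a normal nonspacelike (timelike or isotropic) extremal of the sub-Lorentzian (anti)metric $d$ on $\mathrm{GL}^+(2,\mathbb{C})$ with $g(0)=e$, parametrized by arclength in the timelike case, with real parameters $\alpha_0,\dots,\alpha_6$, i.e. $$g(t)=\exp\left(t\sum_{i=0}^6\alpha_ie_i\right)\exp\left(-t\sum_{i=4}^6\alpha_ie_i\right),$$ where $\alpha_0=\sqrt{1+\alpha_1^2+\alpha_2^2+\alpha_3^2}$ in the timelike case and $\alpha_0=\sqrt{\alpha_1^2+\alpha_2^2+\alpha_3^2}=1$ in the isotropic case. Set $$w_1=\tfrac12\sqrt{(\alpha_1+\mathbf{i}\alpha_4)^2+(\alpha_2+\mathbf{i}\alpha_5)^2+(\alpha_3+\mathbf{i}\alpha_6)^2},\quad w_2=\tfrac12\sqrt{\alpha_4^2+\alpha_5^2+\alpha_6^2},$$ $m_1=\cosh(w_1t)$, $n_1=\sinh(w_1t)/w_1$ if $w_1\ne0$ and $n_1=t$ if $w_1=0$; $m_2=\cos(w_2t)$, $n_2=\sin(w_2t)/w_2$ if $w_2\neq0$ and $n_2=t$ if $w_2=0$. Then $$g(t)=\sum_{i=0}^{6}c_i(t)e_i+c_7(t)\mathbf{i}e_0,$$ where $$c_0(t)=2e^{\alpha_0t/2}(m_1m_2+n_1n_2w_2^2),\quad c_7(t)=-\frac{e^{\alpha_0t/2}}{2}n_1n_2(\alpha_1\alpha_4+\alpha_2\alpha_5+\alpha_3\alpha_6),$$ $$c_1(t)=\frac{e^{\alpha_0t/2}}{2}n_1\left(2\alpha_1m_2+(\alpha_3\alpha_5-\alpha_2\alpha_6)n_2\right),\quad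 c_2(t)=\frac{e^{\alpha_0t/2}}{2}n_1\left(2\alpha_2m_2+(\alpha_1\alpha_6-\alpha_3\alpha_4)n_2\right),$$ $$c_3(t)=\frac{e^{\alpha_0t/2}}{2}n_1\left(2\alpha_3m_2+(\alpha_2\alpha_4-\alpha_1\alpha_5)n_2\right),\quad c_i(t)=e^{\alpha_0t/2}(m_2n_1-m_1n_2)\alpha_i,\ i=4,5,6.$$
   Context: $\mathrm{GL}^+(2,\mathbb{C})$ is the Lie group of complex $2\times2$ matrices with positive real determinant, with unit $e=I$; its Lie algebra $\mathfrak{gl}^+(2,\mathbb{C})$ has the real basis $e_0=\frac12 I$, $e_1=\frac12\begin{pmatrix}0&1\\1&0\end{pmatrix}$, $e_2=\frac12\begin{pmatrix}0&\mathbf{i}\\-\mathbf{i}&0\end{pmatrix}$, $e_3=\frac12\begin{pmatrix}1&0\\0&-1\end{pmatrix}$, $e_4=\mathbf{i}e_1$, $e_5=\mathbf{i}e_2$, $e_6=\mathbf{i}e_3$. $d$ is the left-invariant sub-Lorentzian (anti)metric defined by the space $H=\mathrm{span}_{\mathbb{R}}(e_0,e_1,e_2,e_3)$ of Hermitian matrices with quadratic form $h_0^2-h_1^2-h_2^2-h_3^2=4\det h$ and time orientation $e_0$: $d(x,y)$ is the supremum of lengths of Lipschitzian curves from $x$ to $y$ whose left-translated velocities lie a.e. in $H$, are nonspacelike ($4\det\ge0$) and have positive $e_0$-coordinate. Normal timelike and isotropic extremals (curves satisfying the Pontryagin minimum principle of the corresponding problem with nonzero minimum) with $g(0)=e$ are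 exactly the curves of the displayed product form with parameters subject to the stated relations. The square root in $w_1$ is any complex square root; the result does not depend on its choice. *)

theory Defs
  imports "HOL-Analysis.Analysis"
begin

type_synonym cmat = "complex^2^2"

text \<open>Multiplication of a matrix by a complex scalar; the library operator \<open>*\<^sub>R\<close>
  covers real scalars only, and \<open>*\<close> on \<^typ>\<open>complex^2^2\<close> is not the matrix product.\<close>

definition cscale :: "complex \<Rightarrow> cmat \<Rightarrow> cmat"  (infixr "*\<^sub>c" 75)
  where "c *\<^sub>c A = (\<chi> i j. c * A $ i $ j)"

definition cmat_of :: "complex \<Rightarrow> complex \<Rightarrow> complex \<Rightarrow> complex \<Rightarrow> cmat"
  where "cmat_of a b c d = vector [vector [a, b], vector [c, d]]"

definition mexp :: "cmat \<Rightarrow> cmat"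
  where "mexp A = (\<Sum>n. (1 / fact n) *\<^sub>R (((**) A) ^^ n) (mat 1))"

definition GL2_plus :: "cmat set"
  where "GL2_plus = {A. det A \<in> \<real> \<and> 0 < Re (det A)}"

definition e :: "nat \<Rightarrow> cmat"
  where "e i =
    (if i = 0 then (1/2) *\<^sub>R cmat_of 1 0 0 1
     else if i = 1 then (1/2) *\<^sub>R cmat_of 0 1 1 0
     else if i = 2 then (1/2) *\<^sub>R cmat_of 0 \<i> (- \<i>) 0
     else if i = 3 then (1/2) *\<^sub>R cmat_of 1 0 0 (- 1)
     else if i = 4 then \<i> *\<^sub>c (1/2) *\<^sub>R cmat_of 0 1 1 0
     else if i = 5 then \<i> *\<^sub>c (1/2) *\<^sub>R cmat_of 0 \<i> (- \<i>) 0
     else if i = 6 then \<i> *\<^sub>c (1/2) *\<^sub>R cmat_of 1 0 0 (- 1)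
     else 0)"

definition gl2_plus :: "cmat set"
  where "gl2_plus = span (e ` {0..6})"

definition lie_bracket :: "cmat \<Rightarrow> cmat \<Rightarrow> cmat"
  where "lie_bracket A B = A ** B - B ** A"

definition locally_lipschitz :: "(real \<Rightarrow> 'a::metric_space) \<Rightarrow> bool"
  where "locally_lipschitz f \<longleftrightarrow> (\<forall>a b. \<exists>L. L-lipschitz_on {a..b} f)"

definition hermitian_vector :: "(nat \<Rightarrow> real) \<Rightarrow> cmat"
  where "hermitian_vector h = (\<Sum>i = 0..3. h i *\<^sub>R e i)"

text \<open>Left-translated velocities of future-directed timelike curves parametrized by
  arclength, and of future-directed isotropic curves. Isotropic curves have length zero;
  they are parametrized by the \<open>e 0\<close>-coordinate, i.e. with \<open>h 0 = 1\<close>.\<close>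

definition timelike_controls :: "cmat set"
  where "timelike_controls =
    {hermitian_vector h | h. 0 < h 0 \<and> (h 0)\<^sup>2 - (h 1)\<^sup>2 - (h 2)\<^sup>2 - (h 3)\<^sup>2 = 1}"

definition isotropic_controls :: "cmat set"
  where "isotropic_controls =
    {hermitian_vector h | h. h 0 = 1 \<and> (h 0)\<^sup>2 - (h 1)\<^sup>2 - (h 2)\<^sup>2 - (h 3)\<^sup>2 = 0}"

text \<open>Pontryagin minimum principle for \<open>g' = g u\<close>, \<open>u \<in> U\<close>, with nonzero minimum \<open>M\<close>.
  Here \<open>\<psi> t\<close> is the covector pulled back to the Lie algebra by left translation by \<open>g t\<close>, so
  that the Hamiltonian is \<open>\<psi> t (u t)\<close> and the costate equation reads \<open>\<psi>'(v) = \<psi> [u, v]\<close>.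
  A covector is given by a linear functional on the ambient space of matrices, of which only
  the values on the Lie algebra matter. In contrast to shortest-path problems the
  Hamiltonian is minimized, since length is maximized.\<close>

definition normal_extremal :: "cmat set \<Rightarrow> (real \<Rightarrow> cmat) \<Rightarrow> bool"
  where "normal_extremal U g \<longleftrightarrow>
    (\<forall>t. g t \<in> GL2_plus) \<and> locally_lipschitz g \<and>
    (\<exists>(u :: real \<Rightarrow> cmat) (\<psi> :: real \<Rightarrow> cmat \<Rightarrow> real) M.
      M \<noteq> 0 \<and>
      (\<forall>t. linear (\<psi> t)) \<and>
      (\<forall>v\<in>gl2_plus. locally_lipschitz (\<lambda>t. \<psi> t v)) \<and>
      (AE t in lborel.
        u t \<in> U \<and>
        (g has_vector_derivative g t ** u t) (at t) \<and>
        (\<forall>v\<in>gl2_plus.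
          ((\<lambda>s. \<psi> s v) has_real_derivative \<psi> t (lie_bracket (u t) v)) (at t)) \<and>
        \<psi> t (u t) = M \<and>
        (\<forall>v\<in>U. M \<le> \<psi> t v)))"

end

theory Submission
  imports Defs
begin

text \<open>The extremal is a product of two matrix exponentials, and each of them has a
  closed form.  If \<open>X ** X\<close> is scalar, the combinations of \<open>I\<close> and \<open>X\<close> form a
  commutative algebra, so that the exponential of \<open>a I + X\<close> is a combination of \<open>I\<close> and \<open>X\<close>
  (\<open>mexp_scalar_plus_scalar_square\<close>).  The matrices \<open>e 1, \<dots>, e 6\<close> are traceless, and by
  Cayley--Hamilton a traceless \<open>2 \<times> 2\<close> matrix \<open>X\<close> satisfies \<open>X ** X = (- det X) I\<close>.
  For the first exponent minus its \<open>e 0\<close>-part this square is \<open>w1\<^sup>2\<close>, for the second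
  exponent it is \<open>- w2\<^sup>2\<close>; the hyperbolic functions of the first factor thus become
  circular ones in the second.

  With \<open>P\<close> the Hermitian part \<open>\<alpha> 1 e 1 + \<alpha> 2 e 2 + \<alpha> 3 e 3\<close> and \<open>B\<close> the skew-Hermitian
  part \<open>\<alpha> 4 e 4 + \<alpha> 5 e 5 + \<alpha> 6 e 6\<close>, the product of the two exponentials is
  \<open>exp (\<alpha> 0 t / 2)\<close> times
  \<open>m1 m2 I + n1 m2 (P + B) - m1 n2 B - n1 n2 (P + B) ** B\<close>.  Here \<open>B ** B\<close>
  contributes \<open>w2\<^sup>2\<close> to the coefficient of \<open>I\<close>, and \<open>P ** B\<close> is, by the multiplication
  table of the Pauli matrices, a scalar product (the coefficient \<open>c 7\<close>) plus a
  cross product (the terms with \<open>n1 n2\<close> in \<open>c 1, c 2, c 3\<close>).\<close>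

lemma cscale_nth [simp]: "(c *\<^sub>c A) $ i $ j = c * A $ i $ j"
  by (simp add: cscale_def)

lemma scaleR_eq_cscale: "r *\<^sub>R A = of_real r *\<^sub>c A"
  by (simp add: vec_eq_iff scaleR_conv_of_real [where 'a = complex])

lemma bounded_linear_cscale_left: "bounded_linear (\<lambda>c. c *\<^sub>c A)"
  unfolding linear_conv_bounded_linear [symmetric]
  by (rule linearI) (simp_all add: vec_eq_iff algebra_simps)

text \<open>The coefficients of \<open>I\<close> and \<open>X\<close> in \<open>(a I + X)\<^sup>n\<close> are the even and the odd
  part in \<open>w\<close> of \<open>(a + w)\<^sup>n\<close>; the odd part is divided by \<open>w\<close>, which
  at \<open>w = 0\<close> becomes a derivative.\<close>

lemma matrix_power_scalar_plus_scalar_square: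
  fixes X :: cmat and a w :: complex
  assumes X: "X ** X = w\<^sup>2 *\<^sub>c mat 1"
  shows "(((**) (a *\<^sub>c mat 1 + X)) ^^ n) (mat 1) =
      (((a + w) ^ n + (a - w) ^ n) / 2) *\<^sub>c mat 1 +
      (if w = 0 then of_nat n * a ^ (n - 1) else ((a + w) ^ n - (a - w) ^ n) / (2 * w)) *\<^sub>c X"
proof (induction n)
  case 0
  show ?case by (simp add: vec_eq_iff)
next
  case (Suc n)
  have step: "(a *\<^sub>c mat 1 + X) ** (p *\<^sub>c mat 1 + q *\<^sub>c X) =
      (a * p + w\<^sup>2 * q) *\<^sub>c mat 1 + (p + a * q) *\<^sub>c X" for p q
  proof -
    have "X ** (q *\<^sub>c X) = q *\<^sub>c (X ** X)"
      by (simp add: vec_eq_iff matrix_matrix_mult_def sum_distrib_left mult_ac)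
    moreover have "X ** (p *\<^sub>c mat 1) = p *\<^sub>c X"
      by (simp add: vec_eq_iff matrix_matrix_mult_def mat_def sum_2 forall_2)
    moreover have "(a *\<^sub>c mat 1 + X) ** Y = a *\<^sub>c Y + X ** Y" for Y :: cmat
      by (simp add: vec_eq_iff matrix_matrix_mult_def mat_def sum_2 forall_2 algebra_simps)
    ultimately show ?thesis
      by (simp add: matrix_add_ldistrib X vec_eq_iff algebra_simps)
  qed
  \<comment> \<open>At \<open>n = 0\<close> the truncated exponent is harmless, since its factor \<open>n\<close> vanishes.\<close>
  have q: "of_nat (Suc n) * a ^ n = a ^ n + a * (of_nat n * a ^ (n - 1))"
    by (cases n) (simp_all add: algebra_simps)
  show ?case
  proof (cases "w = 0")
    case True
    then show ?thesis
      using q by (simp add: Suc.IH step)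
  next
    case False
    then have "a * (((a + w) ^ n + (a - w) ^ n) / 2) +
          w\<^sup>2 * (((a + w) ^ n - (a - w) ^ n) / (2 * w)) =
        ((a + w) ^ Suc n + (a - w) ^ Suc n) / 2"
      by (simp add: field_simps power2_eq_square)
    moreover have "((a + w) ^ n + (a - w) ^ n) / 2 + a * (((a + w) ^ n - (a - w) ^ n) / (2 * w)) =
        ((a + w) ^ Suc n - (a - w) ^ Suc n) / (2 * w)"
      using False by (simp add: field_simps)
    ultimately show ?thesis
      using False by (simp only: funpow.simps(2) comp_apply Suc.IH step if_False)
  qed
qed

theorem mexp_scalar_plus_scalar_square:
  fixes X :: cmat and a w :: complex
  assumes X: "X ** X = w\<^sup>2 *\<^sub>c mat 1"
  shows "mexp (a *\<^sub>c mat 1 + X) =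
      exp a *\<^sub>c (cosh w *\<^sub>c mat 1 + (if w = 0 then 1 else sinh w / w) *\<^sub>c X)"
proof -
  define p where "p n = ((a + w) ^ n + (a - w) ^ n) / 2" for n
  define q where "q n = (if w = 0 then of_nat n * a ^ (n - 1)
      else ((a + w) ^ n - (a - w) ^ n) / (2 * w))" for n
  have exp_sums: "(\<lambda>n. z ^ n / fact n) sums exp z" for z :: complex
    using exp_converges [of z] by (simp add: scaleR_conv_of_real divide_inverse mult.commute)
  have "(\<lambda>n. ((a + w) ^ n / fact n + (a - w) ^ n / fact n) / 2) sums ((exp (a + w) + exp (a - w)) / 2)"
    by (intro sums_divide sums_add exp_sums)
  then have p_sums: "(\<lambda>n. p n / fact n) sums (exp a * cosh w)"
    by (simp add: p_def cosh_field_def exp_add exp_diff exp_minus field_simps)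
  have q_sums: "(\<lambda>n. q n / fact n) sums (exp a * (if w = 0 then 1 else sinh w / w))"
  proof (cases "w = 0")
    case True
    have "q (Suc n) / fact (Suc n) = a ^ n / fact n" for n
      using True by (simp add: q_def field_simps del: of_nat_Suc)
    then have "(\<lambda>n. q (Suc n) / fact (Suc n)) sums exp a"
      using exp_sums [of a] by simp
    then show ?thesis
      using True by (subst (asm) sums_Suc_iff) (simp add: q_def)
  next
    case False
    have "(\<lambda>n. ((a + w) ^ n / fact n - (a - w) ^ n / fact n) / (2 * w))
        sums ((exp (a + w) - exp (a - w)) / (2 * w))"
      by (intro sums_divide sums_diff exp_sums)
    moreover have "((a + w) ^ n / fact n - (a - w) ^ n / fact n) / (2 * w) = q n / fact n" for n
      using False by (simp add: q_def diff_divide_distrib mult_ac)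
    moreover have "(exp (a + w) - exp (a - w)) / (2 * w) = exp a * (sinh w / w)"
      using False by (simp add: sinh_field_def exp_add exp_diff exp_minus field_simps)
    ultimately show ?thesis
      using False by simp
  qed
  have "(1 / fact n) *\<^sub>R (((**) (a *\<^sub>c mat 1 + X)) ^^ n) (mat 1) =
      (p n / fact n) *\<^sub>c mat 1 + (q n / fact n) *\<^sub>c X" for n
    unfolding matrix_power_scalar_plus_scalar_square [OF X] p_def [symmetric] q_def [symmetric]
    by (simp add: scaleR_eq_cscale vec_eq_iff algebra_simps)
  moreover have "(\<lambda>n. (p n / fact n) *\<^sub>c mat 1 + (q n / fact n) *\<^sub>c X) sums
      ((exp a * cosh w) *\<^sub>c mat 1 + (exp a * (if w = 0 then 1 else sinh w / w)) *\<^sub>c X)"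
    by (intro sums_add bounded_linear.sums [OF bounded_linear_cscale_left] p_sums q_sums)
  ultimately have "mexp (a *\<^sub>c mat 1 + X) =
      (exp a * cosh w) *\<^sub>c mat 1 + (exp a * (if w = 0 then 1 else sinh w / w)) *\<^sub>c X"
    unfolding mexp_def by (simp add: sums_unique [symmetric])
  then show ?thesis
    by (simp add: vec_eq_iff algebra_simps)
qed

text \<open>The form along a one-parameter subgroup.  Absorbing \<open>t\<close> into the coefficient of \<open>X\<close>
  removes the exception at \<open>t = 0\<close>, and the only case distinction left is that on \<open>w\<close>.\<close>

corollary mexp_scaleR_scalar_plus_scalar_square:
  fixes X :: cmat and a w :: complex and t :: real
  assumes X: "X ** X = w\<^sup>2 *\<^sub>c mat 1"
  shows "mexp (t *\<^sub>R (a *\<^sub>c mat 1 + X)) =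
      exp (a * t) *\<^sub>c (cosh (w * t) *\<^sub>c mat 1 +
        (if w \<noteq> 0 then sinh (w * t) / w else t) *\<^sub>c X)"
proof -
  have sq: "(of_real t *\<^sub>c X) ** (of_real t *\<^sub>c X) = (w * of_real t)\<^sup>2 *\<^sub>c mat 1"
  proof -
    have "(of_real t *\<^sub>c X) ** (of_real t *\<^sub>c X) = (of_real t)\<^sup>2 *\<^sub>c (X ** X)"
      by (simp add: vec_eq_iff matrix_matrix_mult_def sum_distrib_left power2_eq_square mult_ac)
    then show ?thesis
      by (simp add: X vec_eq_iff power_mult_distrib mult_ac)
  qed
  have "t *\<^sub>R (a *\<^sub>c mat 1 + X) = (a * of_real t) *\<^sub>c mat 1 + of_real t *\<^sub>c X"
    by (simp add: scaleR_eq_cscale vec_eq_iff algebra_simps)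
  then show ?thesis
    by (simp only: mexp_scalar_plus_scalar_square [OF sq]) (simp add: vec_eq_iff)
qed

lemma traceless_square:
  fixes x y z :: complex
  shows "cmat_of x y z (- x) ** cmat_of x y z (- x) = (x\<^sup>2 + y * z) *\<^sub>c mat 1"
  by (simp add: cmat_of_def vec_eq_iff matrix_matrix_mult_def mat_def sum_2 forall_2
      power2_eq_square algebra_simps)

text \<open>In both matrices the traceless part has the shape required by \<open>traceless_square\<close>.  The
  second one is written in the combinations \<open>\<alpha> k + \<i> \<alpha> (k + 3)\<close>, because the
  determinant of its traceless part is \<open>- 1 / 4\<close> times the sum of their squares.\<close>

lemma sum_e_entries:
  fixes \<alpha> :: "nat \<Rightarrow> real"
  shows "(\<Sum>i = 4..6. \<alpha> i *\<^sub>R e i) =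
      cmat_of (\<i> * \<alpha> 6 / 2) ((\<i> * \<alpha> 4 - \<alpha> 5) / 2) ((\<i> * \<alpha> 4 + \<alpha> 5) / 2) (- (\<i> * \<alpha> 6 / 2))"
    and "(\<Sum>i = 0..6. \<alpha> i *\<^sub>R e i) = of_real (\<alpha> 0 / 2) *\<^sub>c mat 1 +
      cmat_of ((\<alpha> 3 + \<i> * \<alpha> 6) / 2) (((\<alpha> 1 + \<i> * \<alpha> 4) + \<i> * (\<alpha> 2 + \<i> * \<alpha> 5)) / 2)
        (((\<alpha> 1 + \<i> * \<alpha> 4) - \<i> * (\<alpha> 2 + \<i> * \<alpha> 5)) / 2) (- ((\<alpha> 3 + \<i> * \<alpha> 6) / 2))"
  by (simp_all add: numeral_eq_Suc e_def cmat_of_def vec_eq_iff forall_2 mat_def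
      scaleR_eq_cscale field_simps)

theorem corollary4:
  fixes g :: "real \<Rightarrow> complex^2^2"
    and \<alpha> :: "nat \<Rightarrow> real"
    and s w1 :: complex and w2 :: real
    and m1 n1 :: "real \<Rightarrow> complex" and m2 n2 :: "real \<Rightarrow> real"
    and c :: "nat \<Rightarrow> real \<Rightarrow> complex"
  assumes extremal:
      "normal_extremal timelike_controls g \<and>
         \<alpha> 0 = sqrt (1 + (\<alpha> 1)\<^sup>2 + (\<alpha> 2)\<^sup>2 + (\<alpha> 3)\<^sup>2)
       \<or> normal_extremal isotropic_controls g \<and>
         \<alpha> 0 = sqrt ((\<alpha> 1)\<^sup>2 + (\<alpha> 2)\<^sup>2 + (\<alpha> 3)\<^sup>2) \<and> \<alpha> 0 = 1"
    and start: "g 0 = mat 1"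
    and form: "\<And>t. g t = mexp (t *\<^sub>R (\<Sum>i = 0..6. \<alpha> i *\<^sub>R e i))
                        ** mexp (- t *\<^sub>R (\<Sum>i = 4..6. \<alpha> i *\<^sub>R e i))"
    and s: "s\<^sup>2 = (\<alpha> 1 + \<i> * \<alpha> 4)\<^sup>2 + (\<alpha> 2 + \<i> * \<alpha> 5)\<^sup>2 + (\<alpha> 3 + \<i> * \<alpha> 6)\<^sup>2"
    and w1: "w1 = s / 2"
    and w2: "w2 = sqrt ((\<alpha> 4)\<^sup>2 + (\<alpha> 5)\<^sup>2 + (\<alpha> 6)\<^sup>2) / 2"
    and m1: "\<And>t. m1 t = cosh (w1 * t)"
    and n1: "\<And>t. n1 t = (if w1 \<noteq> 0 then sinh (w1 * t) / w1 else t)"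
    and m2: "\<And>t. m2 t = cos (w2 * t)"
    and n2: "\<And>t. n2 t = (if w2 \<noteq> 0 then sin (w2 * t) / w2 else t)"
    and c0: "\<And>t. c 0 t = 2 * exp (\<alpha> 0 * t / 2) * (m1 t * m2 t + n1 t * n2 t * w2\<^sup>2)"
    and c7: "\<And>t. c 7 t = - (exp (\<alpha> 0 * t / 2) / 2) * n1 t * n2 t
                            * (\<alpha> 1 * \<alpha> 4 + \<alpha> 2 * \<alpha> 5 + \<alpha> 3 * \<alpha> 6)"
    and c1: "\<And>t. c 1 t = exp (\<alpha> 0 * t / 2) / 2 * n1 t
                            * (2 * \<alpha> 1 * m2 t + (\<alpha> 3 * \<alpha> 5 - \<alpha> 2 * \<alpha> 6) * n2 t)"
    and c2: "\<And>t. c 2 t = exp (\<alpha> 0 * t / 2) / 2 * n1 t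
                            * (2 * \<alpha> 2 * m2 t + (\<alpha> 1 * \<alpha> 6 - \<alpha> 3 * \<alpha> 4) * n2 t)"
    and c3: "\<And>t. c 3 t = exp (\<alpha> 0 * t / 2) / 2 * n1 t
                            * (2 * \<alpha> 3 * m2 t + (\<alpha> 2 * \<alpha> 4 - \<alpha> 1 * \<alpha> 5) * n2 t)"
    and c456: "\<And>t i. i \<in> {4, 5, 6} \<Longrightarrow>
                 c i t = exp (\<alpha> 0 * t / 2) * (m2 t * n1 t - m1 t * n2 t) * \<alpha> i"
  shows "\<forall>t. g t = (\<Sum>i = 0..6. c i t *\<^sub>c e i) + c 7 t *\<^sub>c (\<i> *\<^sub>c e 0)"
proof
  fix t
  define X where "X = cmat_of ((\<alpha> 3 + \<i> * \<alpha> 6) / 2)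
      (((\<alpha> 1 + \<i> * \<alpha> 4) + \<i> * (\<alpha> 2 + \<i> * \<alpha> 5)) / 2)
      (((\<alpha> 1 + \<i> * \<alpha> 4) - \<i> * (\<alpha> 2 + \<i> * \<alpha> 5)) / 2) (- ((\<alpha> 3 + \<i> * \<alpha> 6) / 2))"
  define B where "B = cmat_of (\<i> * \<alpha> 6 / 2)
      ((\<i> * \<alpha> 4 - \<alpha> 5) / 2) ((\<i> * \<alpha> 4 + \<alpha> 5) / 2) (- (\<i> * \<alpha> 6 / 2))"
  have XX: "X ** X = w1\<^sup>2 *\<^sub>c mat 1"
    unfolding X_def traceless_square w1 power_divide s
    by (rule arg_cong [where f = "\<lambda>z. z *\<^sub>c mat 1"]) (simp add: field_simps power2_eq_square)
  have w2_sq: "w2\<^sup>2 = ((\<alpha> 4)\<^sup>2 + (\<alpha> 5)\<^sup>2 + (\<alpha> 6)\<^sup>2) / 4"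
    by (simp add: w2 power_divide)
  have BB: "B ** B = (\<i> * of_real w2)\<^sup>2 *\<^sub>c mat 1"
    unfolding B_def traceless_square power_mult_distrib of_real_power [symmetric] w2_sq
    by (rule arg_cong [where f = "\<lambda>z. z *\<^sub>c mat 1"]) (simp add: field_simps power2_eq_square)
  have first: "mexp (t *\<^sub>R (\<Sum>i = 0..6. \<alpha> i *\<^sub>R e i)) =
      of_real (exp (\<alpha> 0 * t / 2)) *\<^sub>c (m1 t *\<^sub>c mat 1 + n1 t *\<^sub>c X)"
    unfolding sum_e_entries X_def [symmetric] mexp_scaleR_scalar_plus_scalar_square [OF XX]
    by (simp add: m1 n1 flip: exp_of_real)
  have second: "mexp (- t *\<^sub>R (\<Sum>i = 4..6. \<alpha> i *\<^sub>R e i)) =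
      of_real (m2 t) *\<^sub>c mat 1 - of_real (n2 t) *\<^sub>c B"
  proof -
    \<comment> \<open>\<open>B\<close> squares to \<open>(\<i> w2)\<^sup>2\<close>, and \<open>cosh z = cos (\<i> z)\<close>, \<open>sinh z = - \<i> sin (\<i> z)\<close>.\<close>
    have arg: "\<i> * (\<i> * of_real w2 * of_real (- t)) = of_real (w2 * t)"
      by (simp flip: mult.assoc)
    have "cosh (\<i> * of_real w2 * of_real (- t)) = of_real (m2 t)"
      unfolding cosh_conv_cos arg by (simp add: m2 cos_of_real del: of_real_mult)
    moreover have "(if \<i> * of_real w2 \<noteq> 0
        then sinh (\<i> * of_real w2 * of_real (- t)) / (\<i> * of_real w2) else of_real (- t)) =
        - of_real (n2 t)"
      unfolding sinh_conv_sin arg by (simp add: n2 sin_of_real del: of_real_mult)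
    ultimately have "mexp (- t *\<^sub>R (0 *\<^sub>c mat 1 + B)) =
        of_real (m2 t) *\<^sub>c mat 1 - of_real (n2 t) *\<^sub>c B"
      by (simp only: mexp_scaleR_scalar_plus_scalar_square [OF BB]) (simp add: vec_eq_iff)
    moreover have "0 *\<^sub>c mat 1 + B = B"
      by (simp add: vec_eq_iff)
    ultimately show ?thesis
      by (simp only: sum_e_entries B_def [symmetric])
  qed
  show "g t = (\<Sum>i = 0..6. c i t *\<^sub>c e i) + c 7 t *\<^sub>c (\<i> *\<^sub>c e 0)"
  proof -
    have "(\<Sum>i = 0..6. c i t *\<^sub>c e i) + c 7 t *\<^sub>c (\<i> *\<^sub>c e 0) =
        (1 / 2) *\<^sub>c cmat_of (c 0 t + \<i> * c 7 t + c 3 t + \<i> * c 6 t)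
          ((c 1 t + \<i> * c 4 t) + \<i> * (c 2 t + \<i> * c 5 t))
          ((c 1 t + \<i> * c 4 t) - \<i> * (c 2 t + \<i> * c 5 t))
          (c 0 t + \<i> * c 7 t - c 3 t - \<i> * c 6 t)"
      by (simp add: numeral_eq_Suc e_def cmat_of_def vec_eq_iff forall_2
          scaleR_eq_cscale field_simps)
    \<comment> \<open>Entrywise a polynomial identity in \<open>m1, n1, m2, n2\<close>, the \<open>\<alpha> i\<close> and the exponential,
      as \<open>w2\<^sup>2\<close> is a quadratic polynomial in the \<open>\<alpha> i\<close>.\<close>
    also have "\<dots> = g t"
      unfolding form first second X_def B_def c0 c1 c2 c3 c7
        of_real_mult of_real_power [symmetric] w2_sq
      by (simp add: c456 cmat_of_def vec_eq_iff forall_2 matrix_matrix_mult_def sum_2 mat_def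
          field_simps power2_eq_square)
    finally show ?thesis by simp
  qed
qed

end
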